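(* Let $a\in\mathbb{R}$, $d,n\in\mathbb{N}$, $\bm s=(s_1,\dots,s_d)\in\mathbb{N}^d$, $|\bm s|_r:=\sum_{i=1}^r s_i$ ($|\bm s|_0=0$), $|\bm s|:=|\bm s|_d$, and for indices $n_1,n_2,\dots$ define $Q(\bm s):=\sum_{r=1}^d\bigl(n_{|\bm s|_{r-1}+1}-n_{|\bm s|_r}\bigr)$. Then \[ \frac1{n+1}\sum_{k=1}^n\zeta_k^\star(\bm s;a)=\sum_{n\ge n_1\ge\cdots\ge n_{|\bm s|+1}\ge1}\frac{\binom{n_{|\bm s|}}{n_{|\bm s|+1}}}{\binom{Q(\bm s)+n_{|\bm s|}}{n_{|\bm s|+1}}}\cdot\frac{a^{n_{|\bm s|+1}}}{(Q(\bm s)+n_{|\bm s|}+1)\,n_1\cdots n_{|\bm s|}}. \]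
   Context: $\zeta_k^\star(s_1,\dots,s_d;a):=\sum_{k\ge m_1\ge\cdots\ge m_d\ge 1}\frac{a^{m_d}}{m_1^{s_1}\cdots m_d^{s_d}}$. In the right-hand side, $Q(\bm s)$ is evaluated at the summation indices $n_1,\dots,n_{|\bm s|}$. *)

theory Defs
  imports Complex_Main "HOL-Library.FuncSet"
begin

(* The tuples N \<ge> m 1 \<ge> ... \<ge> m r \<ge> 1; a tuple is a function on {1..r} that is undefined
   outside {1..r}, so the set is finite. *)
definition noninc_tuples :: "nat \<Rightarrow> nat \<Rightarrow> (nat \<Rightarrow> nat) set" where
  "noninc_tuples r N = {m \<in> {1..r} \<rightarrow>\<^sub>E {1..N}. \<forall>i\<in>{1..r}. \<forall>j\<in>{1..r}. i \<le> j \<longrightarrow> m j \<le> m i}"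

(* A composition (s_1, ..., s_d) is represented by d and the values of s on {1..d}. *)
definition zeta_star :: "nat \<Rightarrow> (nat \<Rightarrow> nat) \<Rightarrow> nat \<Rightarrow> real \<Rightarrow> real" where
  "zeta_star d s k a = (\<Sum>m\<in>noninc_tuples d k. a ^ m d / (\<Prod>i=1..d. real (m i) ^ s i))"

definition partial_weight :: "(nat \<Rightarrow> nat) \<Rightarrow> nat \<Rightarrow> nat" where
  "partial_weight s r = (\<Sum>i=1..r. s i)"

(* Subtraction is truncated here; partial_Q_int shows that no truncation occurs on the
   index tuples that are summed over. *)
definition partial_Q :: "nat \<Rightarrow> (nat \<Rightarrow> nat) \<Rightarrow> (nat \<Rightarrow> nat) \<Rightarrow> nat" where
  "partial_Q d s m = (\<Sum>r=1..d. m (partial_weight s (r - 1) + 1) - m (partial_weight s r))"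

lemma partial_Q_int:
  assumes s: "\<forall>i\<in>{1..d}. 1 \<le> s i" and m: "m \<in> noninc_tuples (partial_weight s d + 1) N"
  shows "int (partial_Q d s m) =
    (\<Sum>r=1..d. int (m (partial_weight s (r - 1) + 1)) - int (m (partial_weight s r)))"
proof -
  have "m (partial_weight s r) \<le> m (partial_weight s (r - 1) + 1)" if r: "r \<in> {1..d}" for r
  proof -
    have "partial_weight s r = partial_weight s (r - 1) + s r"
      using r by (cases r) (auto simp: partial_weight_def)
    moreover have "1 \<le> s r" using s r by blast
    moreover have "partial_weight s r \<le> partial_weight s d"
      unfolding partial_weight_def using r by (intro sum_mono2) auto
    ultimately show ?thesis
      using m unfolding noninc_tuples_def by auto
  qed
  then show ?thesis
    unfolding partial_Q_def of_nat_sum by (intro sum.cong) (auto simp: of_nat_diff)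
qed

end

theory Submission
  imports Defs
begin

text \<open>
  Write the summand on the right as a connector
  \<open>c(N, j, Q) = N! (Q+N-j)! / ((N-j)! (Q+N+1)!)\<close> with \<open>N = n\<^bsub>|s|\<^esub>\<close>, \<open>j = n\<^bsub>|s|+1\<^esub>\<close>,
  and remove the indices \<open>n\<^sub>i\<close> from the innermost outwards. Inside a block, \<open>Q + N\<close> does not depend
  on the last index \<open>N\<close>, and \<open>\<Sum>N=j..M. (N-1)!/(N-j)! = M!/(j (M-j)!)\<close> trades each index for a factor
  \<open>1/j\<close>. At the first index of a block, a telescoping identity trades this index for \<open>1/j\<close> and a new
  summation index \<open>i \<ge> j\<close>, with connector \<open>c(N', i, Q')\<close> belonging to the preceding block. When no
  \<open>n\<^sub>i\<close> is left the connector is \<open>c(n, i, 0) = 1/(n+1)\<close>.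
\<close>

section \<open>The connector and its summation identities\<close>

text \<open>For \<open>j \<le> N\<close> this is
  \<open>(N choose j) / ((Q + N) choose j) / (Q + N + 1)\<close>, written with factorials so that
  the dependence on \<open>N\<close> alone and on \<open>Q + N\<close> separates.\<close>

definition connector :: "nat \<Rightarrow> nat \<Rightarrow> nat \<Rightarrow> real" where
  "connector N j Q = fact N * fact (Q + N - j) / (fact (N - j) * fact (Q + N + 1))"

text \<open>The last entry of a tuple; for the empty tuple it is the bound \<open>N\<close>, as if \<open>m\<^sub>0 = N\<close>.\<close>

definition last_entry :: "nat \<Rightarrow> nat \<Rightarrow> (nat \<Rightarrow> nat) \<Rightarrow> nat" where
  "last_entry r N m = (if r = 0 then N else m r)"

lemma last_entry_0 [simp]: "last_entry 0 N m = N"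
  and last_entry_pos [simp]: "0 < r \<Longrightarrow> last_entry r N m = m r"
  by (simp_all add: last_entry_def)

lemma connector_0: "connector N j 0 = 1 / (real N + 1)"
proof -
  have "(fact (N + 1) :: real) = (real N + 1) * fact N" by simp
  then show ?thesis
    unfolding connector_def add_0 by (simp only:) simp
qed

lemma sum_triangle_swap:
  fixes f :: "nat \<Rightarrow> nat \<Rightarrow> 'a::comm_monoid_add"
  shows "(\<Sum>N=1..M. \<Sum>j=1..N. f N j) = (\<Sum>j=1..M. \<Sum>N=j..M. f N j)"
  unfolding sum.Sigma[OF finite_atLeastAtMost ballI[OF finite_atLeastAtMost]]
  by (rule sum.reindex_bij_witness[where i = prod.swap and j = prod.swap]) auto

text \<open>Hockey-stick identity: each summand is \<open>(j-1)!\<close> times the binomial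
  coefficient \<open>N-1\<close> over \<open>j-1\<close>, and these sum to \<open>M\<close> over
  \<open>j\<close>.\<close>

lemma sum_fact_quotient:
  assumes "1 \<le> j" "j \<le> M"
  shows "(\<Sum>N=j..M. (fact N / fact (N - j) :: real) / real N) = fact M / fact (M - j) / real j"
  using assms(2)
proof (induction M rule: dec_induct)
  case base
  then show ?case by simp
next
  case (step M)
  \<comment> \<open>Writing \<open>M = j + k\<close> removes truncated subtraction from the
    factorials; after \<open>fact_Suc\<close> only a rational identity remains.\<close>
  then obtain k where M: "M = j + k" using le_Suc_ex by blast
  have *: "Suc M - j = Suc k" "M - j = k" by (simp_all add: M)
  have "(\<Sum>N=j..Suc M. (fact N / fact (N - j) :: real) / real N) =
      fact M / fact k / real j + fact (Suc M) / fact (Suc k) / real (Suc M)"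
    using step by (simp add: * del: fact_Suc)
  also have "\<dots> = fact (Suc M) / fact (Suc k) / real j"
    unfolding fact_Suc using assms(1)
    by (simp add: divide_simps M del: fact_Suc) (simp add: algebra_simps)
  finally show ?case unfolding * .
qed

text \<open>Again a hockey-stick sum, of the binomials \<open>Q + N - i\<close> over
  \<open>Q\<close>. The induction descends from \<open>j = N\<close>, each step adding the term of
  smallest index.\<close>

lemma sum_connector:
  assumes "j \<le> N"
  shows "(\<Sum>i=j..N. connector N i Q) =
    fact N * fact (Q + N + 1 - j) / (real (Q + 1) * fact (N - j) * fact (Q + N + 1))"
  using assms
proof (induction j rule: inc_induct)
  case base
  then show ?case by (simp add: connector_def)
next
  case (step j)
  then obtain k where N: "N = Suc j + k" using less_iff_Suc_add by auto
  have *: "N - j = Suc k" "N - Suc j = k" "Q + N + 1 - j = Suc (Suc (Q + k))"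
    "Q + N - j = Suc (Q + k)" "Q + N + 1 - Suc j = Suc (Q + k)"
    by (simp_all add: N)
  have "(\<Sum>i=j..N. connector N i Q) = connector N j Q + (\<Sum>i=Suc j..N. connector N i Q)"
    using step.hyps by (simp add: sum.atLeast_Suc_atMost)
  also have "\<dots> = fact N * fact (Suc (Q + k)) / (fact (Suc k) * fact (Q + N + 1)) +
      fact N * fact (Suc (Q + k)) / (real (Q + 1) * fact k * fact (Q + N + 1))"
    unfolding step.IH * by (simp only: connector_def *)
  also have "\<dots> = fact N * fact (Suc (Suc (Q + k))) / (real (Q + 1) * fact (Suc k) * fact (Q + N + 1))"
    unfolding fact_Suc[of k] fact_Suc[of "Suc (Q + k)"]
    by (simp add: divide_simps del: fact_Suc) (simp add: algebra_simps del: fact_Suc)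
  finally show ?case unfolding * .
qed

text \<open>Here \<open>p\<close> is the first index of a block and \<open>N\<close> the index
  before it. With the closed form of \<open>sum_connector\<close>, the right-hand side telescopes:
  its increment from \<open>N\<close> to \<open>Suc N\<close> is the left summand at
  \<open>p = Suc N\<close>.\<close>

lemma sum_connector_transport:
  assumes "1 \<le> j" "j \<le> N"
  shows "(\<Sum>p=j..N. (fact p / fact (p - j) * (fact (Q + p - j) / fact (Q + p + 1)) :: real) / real p) =
    (\<Sum>i=j..N. connector N i Q) / real j"
  unfolding sum_connector[OF assms(2)] using assms(2)
proof (induction N rule: dec_induct)
  case base
  then show ?case using assms(1) by (simp add: divide_simps)
next
  case (step N)
  then obtain k where N: "N = j + k" using le_Suc_ex by blast
  have *: "Q + Suc N = Suc (Q + N)" "Suc N - j = Suc k" "N - j = k" "Q + N + 1 = Suc (Q + N)"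
    "Suc (Q + N) + 1 = Suc (Suc (Q + N))" "Suc (Q + N) - j = Suc (Q + k)"
    "Suc (Suc (Q + N)) - j = Suc (Suc (Q + k))"
    by (simp_all add: N)
  let ?f = "\<lambda>p. (fact p / fact (p - j) * (fact (Q + p - j) / fact (Q + p + 1)) :: real) / real p"
  have "(\<Sum>p=j..Suc N. ?f p) = (\<Sum>p=j..N. ?f p) + ?f (Suc N)"
    using step.hyps by (simp del: fact_Suc)
  also have "\<dots> = fact N * fact (Suc (Q + k)) / (real (Q + 1) * fact k * fact (Suc (Q + N))) / real j +
      fact (Suc N) / fact (Suc k) * (fact (Suc (Q + k)) / fact (Suc (Suc (Q + N)))) / real (Suc N)"
    unfolding step.IH * ..
  also have "\<dots> = fact (Suc N) * fact (Suc (Suc (Q + k))) /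
      (real (Q + 1) * fact (Suc k) * fact (Suc (Suc (Q + N)))) / real j"
    unfolding fact_Suc[of N] fact_Suc[of k] fact_Suc[of "Suc (Q + k)"] fact_Suc[of "Suc (Q + N)"]
    using assms(1)
    by (simp add: divide_simps del: fact_Suc) (simp add: N algebra_simps del: fact_Suc)
  finally show ?case unfolding * .
qed

section \<open>Peeling off the last entry of a tuple\<close>

lemma finite_noninc_tuples [simp]: "finite (noninc_tuples r N)"
  unfolding noninc_tuples_def by (rule finite_subset[of _ "{1..r} \<rightarrow>\<^sub>E {1..N}"]) (auto intro: finite_PiE)

lemma noninc_tuples_0 [simp]: "noninc_tuples 0 N = {\<lambda>_. undefined}"
  by (auto simp: noninc_tuples_def)

lemma noninc_tuples_iff:
  "m \<in> noninc_tuples r N \<longleftrightarrow>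
    (\<forall>i. i \<in> {1..r} \<longrightarrow> m i \<in> {1..N}) \<and> (\<forall>i. i \<notin> {1..r} \<longrightarrow> m i = undefined) \<and>
    (\<forall>i\<in>{1..r}. \<forall>j\<in>{1..r}. i \<le> j \<longrightarrow> m j \<le> m i)"
  by (simp add: noninc_tuples_def PiE_iff extensional_def Ball_def)

text \<open>The assumption makes \<open>m\<close> recoverable from its update, which would otherwise
  hide an arbitrary value at \<open>Suc r\<close>.\<close>

lemma noninc_tuples_upd_Suc_iff:
  assumes "m (Suc r) = undefined"
  shows "m(Suc r := x) \<in> noninc_tuples (Suc r) N \<longleftrightarrow>
    m \<in> noninc_tuples r N \<and> x \<in> {1..last_entry r N m}"
proof
  assume m: "m(Suc r := x) \<in> noninc_tuples (Suc r) N"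
  have range: "(m(Suc r := x)) i \<in> {1..N}" if "i \<in> {1..Suc r}" for i
    using m that unfolding noninc_tuples_iff by blast
  have undef: "(m(Suc r := x)) i = undefined" if "i \<notin> {1..Suc r}" for i
    using m that unfolding noninc_tuples_iff by blast
  have mono: "(m(Suc r := x)) j \<le> (m(Suc r := x)) i"
    if "i \<in> {1..Suc r}" "j \<in> {1..Suc r}" "i \<le> j" for i j
    using m that unfolding noninc_tuples_iff by blast
  have "m i \<in> {1..N}" if "i \<in> {1..r}" for i
    using range[of i] that by simp
  moreover have "m i = undefined" if "i \<notin> {1..r}" for i
    using undef[of i] that assms by (cases "i = Suc r") auto
  moreover have "m j \<le> m i" if "i \<in> {1..r}" "j \<in> {1..r}" "i \<le> j" for i j
    using mono[of i j] that by simp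
  ultimately have "m \<in> noninc_tuples r N"
    unfolding noninc_tuples_iff by blast
  moreover have "x \<in> {1..last_entry r N m}"
    using range[of "Suc r"] mono[of r "Suc r"] by (cases "r = 0") simp_all
  ultimately show "m \<in> noninc_tuples r N \<and> x \<in> {1..last_entry r N m}" ..
next
  assume m: "m \<in> noninc_tuples r N \<and> x \<in> {1..last_entry r N m}"
  have range: "m i \<in> {1..N}" if "i \<in> {1..r}" for i
    using m that unfolding noninc_tuples_iff by blast
  have undef: "m i = undefined" if "i \<notin> {1..r}" for i
    using m that unfolding noninc_tuples_iff by blast
  have mono: "m j \<le> m i" if "i \<in> {1..r}" "j \<in> {1..r}" "i \<le> j" for i j
    using m that unfolding noninc_tuples_iff by blast
  have x_le: "x \<le> m i" if "i \<in> {1..r}" for i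
    using m mono[OF that, of r] that by simp
  have x_range: "x \<in> {1..N}"
    using m range[of r] by (cases "r = 0") simp_all
  have "(m(Suc r := x)) i \<in> {1..N}" if "i \<in> {1..Suc r}" for i
    using range[of i] x_range that by (cases "i = Suc r") simp_all
  moreover have "(m(Suc r := x)) i = undefined" if "i \<notin> {1..Suc r}" for i
    using undef[of i] that by (cases "i = Suc r") auto
  moreover have "(m(Suc r := x)) j \<le> (m(Suc r := x)) i"
    if "i \<in> {1..Suc r}" "j \<in> {1..Suc r}" "i \<le> j" for i j
    using mono[of i j] x_le[of i] that by (cases "i = Suc r"; cases "j = Suc r") simp_all
  ultimately show "m(Suc r := x) \<in> noninc_tuples (Suc r) N"
    unfolding noninc_tuples_iff by blast
qed

text \<open>Turns a sum over tuples into an iterated sum with the smallest index innermost. The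
  inverse map must reset position \<open>Suc r\<close> to \<open>undefined\<close> to land in the
  shorter tuples.\<close>

lemma sum_noninc_tuples_Suc:
  "(\<Sum>m\<in>noninc_tuples (Suc r) N. f m) =
   (\<Sum>m\<in>noninc_tuples r N. \<Sum>x=1..last_entry r N m. f (m(Suc r := x)))"
  unfolding sum.Sigma[OF finite_noninc_tuples ballI[OF finite_atLeastAtMost]]
proof (rule sum.reindex_bij_witness[where i = "\<lambda>(m, x). m(Suc r := x)"
      and j = "\<lambda>m. (m(Suc r := undefined), m (Suc r))"], goal_cases)
  case (2 m)
  then show ?case
    using noninc_tuples_upd_Suc_iff[of "m(Suc r := undefined)" r "m (Suc r)" N] by simp
next
  case (3 mx)
  then have "fst mx (Suc r) = undefined"
    by (auto simp: noninc_tuples_iff)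
  then show ?case by (auto split: prod.split)
next
  case (4 mx)
  then have "fst mx (Suc r) = undefined"
    by (auto simp: noninc_tuples_iff)
  with 4 show ?case
    by (cases mx) (simp only: noninc_tuples_upd_Suc_iff prod.case fst_conv mem_Sigma_iff)
qed auto

lemma prod_upd_Suc:
  "(\<Prod>i=1..Suc r. f i ((m(Suc r := x)) i)) = (\<Prod>i=1..r. f i (m i)) * f (Suc r) x"
  for f :: "nat \<Rightarrow> 'b \<Rightarrow> 'a::comm_monoid_mult"
  by (simp add: mult.commute)

section \<open>Removing the later indices of a block\<close>

text \<open>Since \<open>\<Phi>\<close> depends only on the first \<open>r\<close> entries, the
  other \<open>t\<close> indices can be summed from the innermost outwards, each leaving a factor
  \<open>1/j\<close>. The induction varies \<open>\<Phi>\<close> because it absorbs these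
  factors.\<close>

lemma sum_block:
  fixes \<Phi> :: "(nat \<Rightarrow> nat) \<Rightarrow> nat \<Rightarrow> real"
  assumes "0 < r" and "\<And>m i x j. r < i \<Longrightarrow> \<Phi> (m(i := x)) j = \<Phi> m j"
  shows "(\<Sum>m\<in>noninc_tuples (r + t) N.
      (\<Sum>j=1..m (r + t). fact (m (r + t)) / fact (m (r + t) - j) * \<Phi> m j) / (\<Prod>i=1..r + t. real (m i))) =
    (\<Sum>m\<in>noninc_tuples r N.
      (\<Sum>j=1..m r. fact (m r) / fact (m r - j) * (\<Phi> m j / real j ^ t)) / (\<Prod>i=1..r. real (m i)))"
  using assms(2)
proof (induction t arbitrary: \<Phi>)
  case 0
  then show ?case by simp
next
  case (Suc t)
  \<comment> \<open>One index \<open>x\<close> is removed: after exchanging the sums over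
    \<open>x\<close> and \<open>j\<close>, the inner sum is that of
    \<open>sum_fact_quotient\<close>.\<close>
  have inner: "(\<Sum>x=1..M. (\<Sum>j=1..x. fact x / fact (x - j) * \<phi> j) / (P * real x)) =
      (\<Sum>j=1..M. fact M / fact (M - j) * (\<phi> j / real j)) / P" for M :: nat and P :: real and \<phi>
  proof -
    have "(\<Sum>x=1..M. (\<Sum>j=1..x. fact x / fact (x - j) * \<phi> j) / (P * real x)) =
        (\<Sum>x=1..M. \<Sum>j=1..x. (fact x / fact (x - j)) / real x * (\<phi> j / P))"
      by (simp add: sum_divide_distrib mult_ac)
    also have "\<dots> = (\<Sum>j=1..M. (\<Sum>x=j..M. (fact x / fact (x - j)) / real x) * (\<phi> j / P))"
      by (simp only: sum_triangle_swap sum_distrib_right)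
    also have "\<dots> = (\<Sum>j=1..M. fact M / fact (M - j) * (\<phi> j / real j)) / P"
      unfolding sum_divide_distrib
      by (intro sum.cong refl, subst sum_fact_quotient) auto
    finally show ?thesis .
  qed
  have "(\<Sum>m\<in>noninc_tuples (r + Suc t) N.
      (\<Sum>j=1..m (r + Suc t). fact (m (r + Suc t)) / fact (m (r + Suc t) - j) * \<Phi> m j) /
        (\<Prod>i=1..r + Suc t. real (m i))) =
    (\<Sum>m\<in>noninc_tuples (r + t) N. \<Sum>x=1..m (r + t).
      (\<Sum>j=1..x. fact x / fact (x - j) * \<Phi> m j) / ((\<Prod>i=1..r + t. real (m i)) * real x))"
    unfolding add_Suc_right sum_noninc_tuples_Suc prod_upd_Suc
    using assms(1) by (simp add: Suc.prems)
  also have "\<dots> = (\<Sum>m\<in>noninc_tuples (r + t) N.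
      (\<Sum>j=1..m (r + t). fact (m (r + t)) / fact (m (r + t) - j) * (\<Phi> m j / real j)) /
        (\<Prod>i=1..r + t. real (m i)))"
    unfolding inner ..
  also have "\<dots> = (\<Sum>m\<in>noninc_tuples r N.
      (\<Sum>j=1..m r. fact (m r) / fact (m r - j) * (\<Phi> m j / real j / real j ^ t)) / (\<Prod>i=1..r. real (m i)))"
    by (rule Suc.IH) (simp only: Suc.prems)
  finally show ?case by (simp add: mult_ac)
qed

section \<open>Block boundaries and the quantity Q\<close>

lemma partial_weight_0 [simp]: "partial_weight s 0 = 0"
  and partial_weight_Suc: "partial_weight s (Suc d) = partial_weight s d + s (Suc d)"
  by (simp_all add: partial_weight_def)

lemma partial_weight_mono: "r \<le> d \<Longrightarrow> partial_weight s r \<le> partial_weight s d"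
  unfolding partial_weight_def by (rule sum_mono2) auto

lemma partial_Q_0 [simp]: "partial_Q 0 s m = 0"
  and partial_Q_Suc: "partial_Q (Suc d) s m =
    partial_Q d s m + (m (partial_weight s d + 1) - m (partial_weight s (Suc d)))"
  by (simp_all add: partial_Q_def)

text \<open>All positions read by \<open>partial_Q\<close> are at most
  \<open>partial_weight s d\<close>: as \<open>s r\<close> is positive, a block starts no later than
  it ends. Hence \<open>Q\<close> is constant while later indices are summed.\<close>

lemma partial_Q_upd:
  assumes "\<forall>i\<in>{1..d}. 1 \<le> s i" "partial_weight s d < k"
  shows "partial_Q d s (m(k := x)) = partial_Q d s m"
  unfolding partial_Q_def
proof (rule sum.cong[OF refl])
  fix r assume r: "r \<in> {1..d}"
  then have "partial_weight s r = partial_weight s (r - 1) + s r"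
    using partial_weight_Suc[of s "r - 1"] by simp
  moreover have "1 \<le> s r" using assms(1) r by blast
  ultimately have "partial_weight s (r - 1) + 1 \<noteq> k" "partial_weight s r \<noteq> k"
    using partial_weight_mono[of r d s] r assms(2) by auto
  then show "(m(k := x)) (partial_weight s (r - 1) + 1) - (m(k := x)) (partial_weight s r) =
      m (partial_weight s (r - 1) + 1) - m (partial_weight s r)"
    by simp
qed

section \<open>Transport of the connector through blocks\<close>

text \<open>Removing the last block turns the weight \<open>h\<close> into its partial sums with
  divisor \<open>j ^ s (Suc d)\<close>: all indices but the first give \<open>1/j\<close> each by
  \<open>sum_block\<close>, the first gives \<open>1/j\<close> and the new index
  \<open>i\<close>.\<close>

lemma sum_connector_block:
  assumes s: "\<forall>i\<in>{1..Suc d}. 1 \<le> s i"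
  shows "(\<Sum>m\<in>noninc_tuples (partial_weight s (Suc d)) n.
      (\<Sum>j=1..m (partial_weight s (Suc d)).
        connector (m (partial_weight s (Suc d))) j (partial_Q (Suc d) s m) * h j) /
      (\<Prod>i=1..partial_weight s (Suc d). real (m i))) =
    (\<Sum>m\<in>noninc_tuples (partial_weight s d) n.
      (\<Sum>i=1..last_entry (partial_weight s d) n m.
        connector (last_entry (partial_weight s d) n m) i (partial_Q d s m) *
        (\<Sum>j=1..i. h j / real j ^ s (Suc d))) /
      (\<Prod>i=1..partial_weight s d. real (m i)))"
proof -
  define W where "W = partial_weight s d"
  define t where "t = s (Suc d) - 1"
  \<comment> \<open>The part of the connector that is constant along the block: \<open>Q\<close>
    plus the last index equals the earlier \<open>Q\<close> plus the first index,
    \<open>m (Suc W)\<close>.\<close>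
  define \<Phi> :: "(nat \<Rightarrow> nat) \<Rightarrow> nat \<Rightarrow> real" where
    "\<Phi> m j = fact (partial_Q d s m + m (Suc W) - j) / fact (partial_Q d s m + m (Suc W) + 1) * h j" for m j
  have "1 \<le> s (Suc d)" using s by auto
  then have st: "s (Suc d) = Suc t" and W': "partial_weight s (Suc d) = Suc W + t"
    by (simp_all add: t_def W_def partial_weight_Suc)
  have Q_upd: "partial_Q d s (m(k := x)) = partial_Q d s m" if "W < k" for m k x
    using s that by (intro partial_Q_upd) (auto simp: W_def)
  have first: "(\<Sum>m\<in>noninc_tuples (Suc W + t) n.
      (\<Sum>j=1..m (Suc W + t). connector (m (Suc W + t)) j (partial_Q (Suc d) s m) * h j) /
      (\<Prod>i=1..Suc W + t. real (m i))) =
    (\<Sum>m\<in>noninc_tuples (Suc W + t) n.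
      (\<Sum>j=1..m (Suc W + t). fact (m (Suc W + t)) / fact (m (Suc W + t) - j) * \<Phi> m j) /
      (\<Prod>i=1..Suc W + t. real (m i)))"
  proof (intro sum.cong refl arg_cong2[where f = "(/)"])
    fix m j assume m: "m \<in> noninc_tuples (Suc W + t) n"
    \<comment> \<open>Monotonicity makes the truncated subtraction in \<open>partial_Q\<close>
      exact, so the last index cancels from the sum.\<close>
    then have "m (Suc W + t) \<le> m (Suc W)" by (auto simp: noninc_tuples_def)
    then have "partial_Q (Suc d) s m + m (Suc W + t) = partial_Q d s m + m (Suc W)"
      using W' by (simp add: partial_Q_Suc W_def)
    then show "connector (m (Suc W + t)) j (partial_Q (Suc d) s m) * h j =
        fact (m (Suc W + t)) / fact (m (Suc W + t) - j) * \<Phi> m j"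
      by (simp add: connector_def \<Phi>_def del: fact_Suc)
  qed
  \<comment> \<open>\<open>M\<close> stands for the index before the block, or for \<open>n\<close>
    if there is none. The sums over \<open>p\<close> and \<open>j\<close> are exchanged,
    \<open>sum_connector_transport\<close> brings in \<open>i\<close>, and a second exchange puts
    \<open>i\<close> outside.\<close>
  have transport: "(\<Sum>p=1..M. (\<Sum>j=1..p. fact p / fact (p - j) *
        (fact (Q + p - j) / fact (Q + p + 1) * h j / real j ^ t)) / (P * real p)) =
      (\<Sum>i=1..M. connector M i Q * (\<Sum>j=1..i. h j / real j ^ Suc t)) / P" for M Q :: nat and P :: real
  proof -
    have "(\<Sum>p=1..M. (\<Sum>j=1..p. fact p / fact (p - j) *
        (fact (Q + p - j) / fact (Q + p + 1) * h j / real j ^ t)) / (P * real p)) =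
      (\<Sum>p=1..M. \<Sum>j=1..p. (fact p / fact (p - j) * (fact (Q + p - j) / fact (Q + p + 1))) / real p *
        (h j / real j ^ t / P))"
      by (simp add: sum_divide_distrib mult_ac del: fact_Suc)
    also have "\<dots> = (\<Sum>j=1..M. (\<Sum>p=j..M. (fact p / fact (p - j) *
        (fact (Q + p - j) / fact (Q + p + 1))) / real p) * (h j / real j ^ t / P))"
      by (simp only: sum_triangle_swap sum_distrib_right)
    also have "\<dots> = (\<Sum>j=1..M. \<Sum>i=j..M. connector M i Q * (h j / real j ^ Suc t) / P)"
    proof (intro sum.cong refl)
      fix j assume "j \<in> {1..M}"
      then show "(\<Sum>p=j..M. (fact p / fact (p - j) * (fact (Q + p - j) / fact (Q + p + 1))) / real p) *
          (h j / real j ^ t / P) = (\<Sum>i=j..M. connector M i Q * (h j / real j ^ Suc t) / P)"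
        by (subst sum_connector_transport) (simp_all add: sum_distrib_right[symmetric] sum_divide_distrib[symmetric])
    qed
    also have "\<dots> = (\<Sum>i=1..M. connector M i Q * (\<Sum>j=1..i. h j / real j ^ Suc t)) / P"
      unfolding sum_triangle_swap[symmetric] by (simp only: sum_divide_distrib sum_distrib_left)
    finally show ?thesis .
  qed
  have "(\<Sum>m\<in>noninc_tuples (Suc W + t) n.
      (\<Sum>j=1..m (Suc W + t). fact (m (Suc W + t)) / fact (m (Suc W + t) - j) * \<Phi> m j) /
      (\<Prod>i=1..Suc W + t. real (m i))) =
    (\<Sum>m\<in>noninc_tuples (Suc W) n.
      (\<Sum>j=1..m (Suc W). fact (m (Suc W)) / fact (m (Suc W) - j) * (\<Phi> m j / real j ^ t)) /
      (\<Prod>i=1..Suc W. real (m i)))"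
    by (rule sum_block) (simp_all add: \<Phi>_def Q_upd)
  also have "\<dots> = (\<Sum>m\<in>noninc_tuples W n.
      (\<Sum>i=1..last_entry W n m. connector (last_entry W n m) i (partial_Q d s m) *
        (\<Sum>j=1..i. h j / real j ^ Suc t)) / (\<Prod>i=1..W. real (m i)))"
    unfolding sum_noninc_tuples_Suc prod_upd_Suc transport[symmetric] \<Phi>_def
    by (simp add: Q_upd del: fact_Suc)
  finally show ?thesis
    unfolding W' first st W_def[symmetric] .
qed

text \<open>Induction on the number of blocks, for arbitrary \<open>h\<close> because each removed
  block replaces \<open>h\<close> by partial sums. With no block left the connector is
  \<open>1 / (n + 1)\<close>, and the remaining index becomes \<open>k\<close>.\<close>

lemma sum_connector_eq:
  assumes "\<forall>i\<in>{1..d}. 1 \<le> s i"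
  shows "(\<Sum>m\<in>noninc_tuples (partial_weight s d) n.
      (\<Sum>j=1..last_entry (partial_weight s d) n m.
        connector (last_entry (partial_weight s d) n m) j (partial_Q d s m) * h j) /
      (\<Prod>i=1..partial_weight s d. real (m i))) =
    (\<Sum>k=1..n. \<Sum>m\<in>noninc_tuples d k. h (last_entry d k m) / (\<Prod>i=1..d. real (m i) ^ s i)) /
      (real n + 1)"
  using assms
proof (induction d arbitrary: h)
  case 0
  then show ?case by (simp add: connector_0 sum_divide_distrib)
next
  case (Suc d)
  have "1 \<le> s (Suc d)" using Suc.prems by auto
  then have pos: "0 < partial_weight s (Suc d)" by (simp add: partial_weight_Suc)
  \<comment> \<open>Splitting off the smallest index of the star sum changes \<open>h\<close>
    exactly as removing a block does, so both sides obey the same recursion.\<close>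
  have peel: "(\<Sum>m\<in>noninc_tuples (Suc d) k. h (last_entry (Suc d) k m) / (\<Prod>i=1..Suc d. real (m i) ^ s i)) =
      (\<Sum>m\<in>noninc_tuples d k. (\<Sum>j=1..last_entry d k m. h j / real j ^ s (Suc d)) /
        (\<Prod>i=1..d. real (m i) ^ s i))" for k
    unfolding sum_noninc_tuples_Suc prod_upd_Suc[where f = "\<lambda>i y. real y ^ s i"]
    by (simp add: sum_divide_distrib mult_ac)
  have "\<forall>i\<in>{1..d}. 1 \<le> s i" using Suc.prems by auto
  note IH = Suc.IH[OF this]
  show ?case
    unfolding last_entry_pos[OF pos] sum_connector_block[OF Suc.prems] IH peel ..
qed

section \<open>From binomial coefficients to the connector\<close>

theorem theorem6:
  fixes a :: real and d n :: nat and s :: "nat \<Rightarrow> nat"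
  assumes "1 \<le> d" and "1 \<le> n" and "\<forall>i\<in>{1..d}. 1 \<le> s i"
  shows "1 / (real n + 1) * (\<Sum>k=1..n. zeta_star d s k a) =
    (\<Sum>m\<in>noninc_tuples (partial_weight s d + 1) n.
      real (m (partial_weight s d) choose m (partial_weight s d + 1)) /
      real ((partial_Q d s m + m (partial_weight s d)) choose m (partial_weight s d + 1)) *
      (a ^ m (partial_weight s d + 1) /
        ((real (partial_Q d s m) + real (m (partial_weight s d)) + 1) *
          (\<Prod>i=1..partial_weight s d. real (m i)))))"
proof -
  let ?W = "partial_weight s d"
  have "1 \<le> s 1" using assms by auto
  then have W: "0 < ?W"
    using partial_weight_mono[of 1 d s] assms(1) by (simp add: partial_weight_def)
  have connector: "real (N choose j) / real ((Q + N) choose j) * (a ^ j / ((real Q + real N + 1) * P)) =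
      connector N j Q * a ^ j / P" if "j \<in> {1..N}" for N j Q and P :: real
  proof -
    have "j \<le> N" "j \<le> Q + N" using that by auto
    note binomial = this[THEN binomial_fact]
    have "(fact (Q + N + 1) :: real) = (real Q + real N + 1) * fact (Q + N)"
      by simp
    then show ?thesis
      unfolding connector_def binomial by (simp only:) simp
  qed
  \<comment> \<open>The final index of the tuple is split off as \<open>j\<close>; neither
    \<open>Q\<close> nor the product involves it, so the sum takes the form of
    \<open>sum_connector_eq\<close> with \<open>h j = a ^ j\<close>.\<close>
  have "(\<Sum>m\<in>noninc_tuples (?W + 1) n.
      real (m ?W choose m (?W + 1)) / real ((partial_Q d s m + m ?W) choose m (?W + 1)) *
      (a ^ m (?W + 1) / ((real (partial_Q d s m) + real (m ?W) + 1) * (\<Prod>i=1..?W. real (m i))))) =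
    (\<Sum>m\<in>noninc_tuples ?W n. (\<Sum>j=1..m ?W. connector (m ?W) j (partial_Q d s m) * a ^ j) /
      (\<Prod>i=1..?W. real (m i)))"
    unfolding Suc_eq_plus1[symmetric] sum_noninc_tuples_Suc sum_divide_distrib last_entry_pos[OF W]
  proof (intro sum.cong refl)
    fix m :: "nat \<Rightarrow> nat" and j assume "j \<in> {1..m ?W}"
    moreover have "(\<Prod>i=1..?W. real ((m(Suc ?W := j)) i)) = (\<Prod>i=1..?W. real (m i))"
      by (intro prod.cong) auto
    moreover have "partial_Q d s (m(Suc ?W := j)) = partial_Q d s m"
      using assms(3) by (simp add: partial_Q_upd)
    ultimately show "real ((m(Suc ?W := j)) ?W choose (m(Suc ?W := j)) (Suc ?W)) /
        real ((partial_Q d s (m(Suc ?W := j)) + (m(Suc ?W := j)) ?W) choose (m(Suc ?W := j)) (Suc ?W)) *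
        (a ^ (m(Suc ?W := j)) (Suc ?W) /
          ((real (partial_Q d s (m(Suc ?W := j))) + real ((m(Suc ?W := j)) ?W) + 1) *
            (\<Prod>i=1..?W. real ((m(Suc ?W := j)) i)))) =
      connector (m ?W) j (partial_Q d s m) * a ^ j / (\<Prod>i=1..?W. real (m i))"
      by (simp only: fun_upd_same fun_upd_other n_not_Suc_n not_False_eq_True connector)
  qed
  also have "\<dots> = (\<Sum>k=1..n. \<Sum>m\<in>noninc_tuples d k. a ^ m d / (\<Prod>i=1..d. real (m i) ^ s i)) /
      (real n + 1)"
    using sum_connector_eq[OF assms(3), of n "\<lambda>j. a ^ j"] W assms(1) by simp
  finally show ?thesis
    by (simp add: zeta_star_def)
qed

end
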